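(* Let $\mathbf{U}_k\in\mathbb{R}^{m\times k}$ satisfy $\mathbf{U}_k^\top\mathbf{U}_k=\mathbf{I}$, and let $\mathbf{B}=[\mathbf{b}_1,\dots,\mathbf{b}_s]\in\mathbb{R}^{m\times s}$ be an arbitrary sparse matrix with columns $\mathbf{b}_1,\dots,\mathbf{b}_s$. Then the column space of $(\mathbf{I}-\mathbf{U}_k\mathbf{U}_k^\top)\mathbf{B}$ (with the standard dot product of $\mathbb{R}^m$) is isometric to the inner product space spanned by the SV-LCOV forms $(\mathbf{b}_1,\mathbf{U}_k^\top\mathbf{b}_1)_{\mathbf{U}_k},\dots,(\mathbf{b}_s,\mathbf{U}_k^\top\mathbf{b}_s)_{\mathbf{U}_k}$ of its columns.
   Context: For $\mathbf{U}_k\in\mathbb{R}^{m\times k}$ with $\mathbf{U}_k^\top\mathbf{U}_k=\mathbf{I}$ and a sparse vector $\mathbf{b}\in\mathbb{R}^m$, the SV-LCOV form of the vector $\mathbf{z}=(\mathbf{I}-\mathbf{U}_k\mathbf{U}_k^\top)\mathbf{b}=\mathbf{b}-\mathbf{U}_k\mathbf{c}$ is the tuple denoted $(\mathbf{b},\mathbf{c})_{\mathbf{U}_k}$, where $\mathbf{c}=\mathbf{U}_k^\top\mathbf{b}\in\mathbb{R}^k$. A tuple stands for the vector $\mathbf{b}-\mathbf{U}_k\mathbf{c}$ it represents; tuples representing the same vector are identified. Operations on SV-LCOV tuples are defined by $\alpha(\mathbf{b},\mathbf{c})_{\mathbf{U}_k}=(\alpha\mathbf{b},\alpha\mathbf{c})_{\mathbf{U}_k}$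 for $\alpha\in\mathbb{R}$, $(\mathbf{b}_1,\mathbf{c}_1)_{\mathbf{U}_k}+(\mathbf{b}_2,\mathbf{c}_2)_{\mathbf{U}_k}=(\mathbf{b}_1+\mathbf{b}_2,\mathbf{c}_1+\mathbf{c}_2)_{\mathbf{U}_k}$, and $\langle(\mathbf{b}_1,\mathbf{c}_1)_{\mathbf{U}_k},(\mathbf{b}_2,\mathbf{c}_2)_{\mathbf{U}_k}\rangle=\langle\mathbf{b}_1,\mathbf{b}_2\rangle-\langle\mathbf{c}_1,\mathbf{c}_2\rangle$, with the standard dot product on the right. Two inner product spaces are isometric if there is a linear bijection between them that preserves the inner product. "Sparse" imposes no mathematical restriction. *)

theory Defs
  imports "HOL-Analysis.Analysis"
begin

record 'a ips =
  vecs :: "'a set"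
  vzero :: 'a
  vadd :: "'a \<Rightarrow> 'a \<Rightarrow> 'a"
  vscale :: "real \<Rightarrow> 'a \<Rightarrow> 'a"
  vinner :: "'a \<Rightarrow> 'a \<Rightarrow> real"

locale inner_product_space =
  fixes V :: "'a ips"
  assumes zero_closed: "vzero V \<in> vecs V"
    and add_closed: "\<lbrakk>x \<in> vecs V; y \<in> vecs V\<rbrakk> \<Longrightarrow> vadd V x y \<in> vecs V"
    and scale_closed: "x \<in> vecs V \<Longrightarrow> vscale V a x \<in> vecs V"
    and add_assoc: "\<lbrakk>x \<in> vecs V; y \<in> vecs V; z \<in> vecs V\<rbrakk>
      \<Longrightarrow> vadd V (vadd V x y) z = vadd V x (vadd V y z)"
    and add_commute: "\<lbrakk>x \<in> vecs V; y \<in> vecs V\<rbrakk> \<Longrightarrow> vadd V x y = vadd V y x"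
    and add_zero: "x \<in> vecs V \<Longrightarrow> vadd V (vzero V) x = x"
    and add_inverse: "x \<in> vecs V \<Longrightarrow> \<exists>y\<in>vecs V. vadd V x y = vzero V"
    and scale_add_right: "\<lbrakk>x \<in> vecs V; y \<in> vecs V\<rbrakk>
      \<Longrightarrow> vscale V a (vadd V x y) = vadd V (vscale V a x) (vscale V a y)"
    and scale_add_left: "x \<in> vecs V
      \<Longrightarrow> vscale V (a + b) x = vadd V (vscale V a x) (vscale V b x)"
    and scale_scale: "x \<in> vecs V \<Longrightarrow> vscale V a (vscale V b x) = vscale V (a * b) x"
    and scale_one: "x \<in> vecs V \<Longrightarrow> vscale V 1 x = x"
    and inner_commute: "\<lbrakk>x \<in> vecs V; y \<in> vecs V\<rbrakk> \<Longrightarrow> vinner V x y = vinner V y x"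
    and inner_add_left: "\<lbrakk>x \<in> vecs V; y \<in> vecs V; z \<in> vecs V\<rbrakk>
      \<Longrightarrow> vinner V (vadd V x y) z = vinner V x z + vinner V y z"
    and inner_scale_left: "\<lbrakk>x \<in> vecs V; y \<in> vecs V\<rbrakk>
      \<Longrightarrow> vinner V (vscale V a x) y = a * vinner V x y"
    and inner_nonneg: "x \<in> vecs V \<Longrightarrow> vinner V x x \<ge> 0"
    and inner_eq_zero: "x \<in> vecs V \<Longrightarrow> vinner V x x = 0 \<Longrightarrow> x = vzero V"

definition linear_subspace :: "'a ips \<Rightarrow> 'a set \<Rightarrow> bool" where
  "linear_subspace V W \<longleftrightarrow> W \<subseteq> vecs V \<and> vzero V \<in> W \<and>
    (\<forall>x\<in>W. \<forall>y\<in>W. vadd V x y \<in> W) \<and> (\<forall>a. \<forall>x\<in>W. vscale V a x \<in> W)"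

definition spanned_space :: "'a ips \<Rightarrow> 'a set \<Rightarrow> 'a ips" where
  "spanned_space V S = V\<lparr>vecs := linear_subspace V hull S\<rparr>"

definition isometric :: "'a ips \<Rightarrow> 'b ips \<Rightarrow> bool" where
  "isometric V W \<longleftrightarrow> inner_product_space V \<and> inner_product_space W \<and>
    (\<exists>f. bij_betw f (vecs V) (vecs W) \<and>
      (\<forall>x\<in>vecs V. \<forall>y\<in>vecs V. f (vadd V x y) = vadd W (f x) (f y)) \<and>
      (\<forall>a. \<forall>x\<in>vecs V. f (vscale V a x) = vscale W a (f x)) \<and>
      (\<forall>x\<in>vecs V. \<forall>y\<in>vecs V. vinner W (f x) (f y) = vinner V x y))"

definition column_space :: "real^'s^'m \<Rightarrow> (real^'m) ips" where
  "column_space A = \<lparr>vecs = span (columns A), vzero = 0, vadd = (+), vscale = (*\<^sub>R),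
    vinner = (\<bullet>)\<rparr>"

text \<open>
  Only pairs with \<open>c = transpose U *v b\<close> occur: on arbitrary pairs the inner product would depend on
  the choice of the representing tuple.
\<close>

definition lcov_tuples :: "real^'k^'m \<Rightarrow> ((real^'m) \<times> (real^'k)) set" where
  "lcov_tuples U = {(b, c). c = transpose U *v b}"

definition lcov_vec :: "real^'k^'m \<Rightarrow> (real^'m) \<times> (real^'k) \<Rightarrow> real^'m" where
  "lcov_vec U = (\<lambda>(b, c). b - U *v c)"

definition lcov_rel ::
    "real^'k^'m \<Rightarrow> (((real^'m) \<times> (real^'k)) \<times> ((real^'m) \<times> (real^'k))) set" where
  "lcov_rel U = {(p, q). p \<in> lcov_tuples U \<and> q \<in> lcov_tuples U \<and> lcov_vec U p = lcov_vec U q}"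

definition lcov_form :: "real^'k^'m \<Rightarrow> real^'m \<Rightarrow> ((real^'m) \<times> (real^'k)) set" where
  "lcov_form U b = lcov_rel U `` {(b, transpose U *v b)}"

text \<open>This is not the inner product of the product space, which would add the two terms.\<close>

definition tuple_inner :: "(real^'m) \<times> (real^'k) \<Rightarrow> (real^'m) \<times> (real^'k) \<Rightarrow> real" where
  "tuple_inner = (\<lambda>(b1, c1) (b2, c2). b1 \<bullet> b2 - c1 \<bullet> c2)"

text \<open>
  The vectors are the classes of tuples that represent the same vector. The operations on classes
  are induced by those on representatives (addition and scaling of pairs are componentwise); the
  lemmas below show that they do not depend on the representatives.
\<close>

definition lcov_space :: "real^'k^'m \<Rightarrow> ((real^'m) \<times> (real^'k)) set ips" where
  "lcov_space U = \<lparr>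
    vecs = lcov_tuples U // lcov_rel U,
    vzero = lcov_rel U `` {0},
    vadd = (\<lambda>X Y. \<Union>p\<in>X. \<Union>q\<in>Y. lcov_rel U `` {p + q}),
    vscale = (\<lambda>a X. \<Union>p\<in>X. lcov_rel U `` {a *\<^sub>R p}),
    vinner = (\<lambda>X Y. the_elem (\<Union>p\<in>X. \<Union>q\<in>Y. {tuple_inner p q}))\<rparr>"

lemma equiv_lcov_rel: "equiv (lcov_tuples U) (lcov_rel U)"
  by (rule equivI) (auto simp: lcov_rel_def refl_on_def sym_def trans_def)

lemma lcov_tuples_add: "\<lbrakk>p \<in> lcov_tuples U; q \<in> lcov_tuples U\<rbrakk> \<Longrightarrow> p + q \<in> lcov_tuples U"
  by (auto simp: lcov_tuples_def matrix_vector_right_distrib simp del: transpose_matrix_vector)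

lemma lcov_tuples_scale: "p \<in> lcov_tuples U \<Longrightarrow> a *\<^sub>R p \<in> lcov_tuples U"
  by (auto simp: lcov_tuples_def matrix_vector_mult_scaleR simp del: transpose_matrix_vector)

lemma lcov_vec_add: "lcov_vec U (p + q) = lcov_vec U p + lcov_vec U q"
  by (simp add: lcov_vec_def split_beta matrix_vector_right_distrib)

lemma lcov_vec_scale: "lcov_vec U (a *\<^sub>R p) = a *\<^sub>R lcov_vec U p"
  by (simp add: lcov_vec_def split_beta matrix_vector_mult_scaleR scaleR_diff_right)

lemma tuple_inner_lcov_vec:
  assumes U: "transpose U ** U = mat 1" and p: "p \<in> lcov_tuples U" and q: "q \<in> lcov_tuples U"
  shows "tuple_inner p q = lcov_vec U p \<bullet> lcov_vec U q"
proof -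
  obtain b c where p': "p = (b, c)" "c = transpose U *v b" using p by (auto simp: lcov_tuples_def)
  obtain d e where q': "q = (d, e)" "e = transpose U *v d" using q by (auto simp: lcov_tuples_def)
  have adj: "(U *v x) \<bullet> y = x \<bullet> (transpose U *v y)" for x y
    by (metis dot_lmul_matrix transpose_matrix_vector transpose_transpose)
  have "(U *v c) \<bullet> (U *v e) = c \<bullet> e"
    by (simp add: adj matrix_vector_mul_assoc U)
  moreover have "(U *v c) \<bullet> d = c \<bullet> e" by (simp add: adj q')
  moreover have "b \<bullet> (U *v e) = c \<bullet> e" by (metis adj inner_commute p'(2))
  ultimately show ?thesis
    by (simp add: tuple_inner_def lcov_vec_def p'(1) q'(1) inner_diff_left inner_diff_right)
qed

lemma lcov_add_congruent:
  "(\<lambda>p q. lcov_rel U `` {p + q}) respects2 lcov_rel U"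
proof (intro congruent2I')
  fix p p' q q' assume "(p, p') \<in> lcov_rel U" "(q, q') \<in> lcov_rel U"
  then have "(p + q, p' + q') \<in> lcov_rel U"
    by (auto simp: lcov_rel_def lcov_tuples_add lcov_vec_add)
  then show "lcov_rel U `` {p + q} = lcov_rel U `` {p' + q'}"
    by (rule equiv_class_eq[OF equiv_lcov_rel])
qed

lemma lcov_scale_congruent: "(\<lambda>p. lcov_rel U `` {a *\<^sub>R p}) respects lcov_rel U"
proof (intro congruentI)
  fix p p' assume "(p, p') \<in> lcov_rel U"
  then have "(a *\<^sub>R p, a *\<^sub>R p') \<in> lcov_rel U"
    by (auto simp: lcov_rel_def lcov_tuples_scale lcov_vec_scale)
  then show "lcov_rel U `` {a *\<^sub>R p} = lcov_rel U `` {a *\<^sub>R p'}"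
    by (rule equiv_class_eq[OF equiv_lcov_rel])
qed

lemma tuple_inner_congruent:
  "transpose U ** U = mat 1 \<Longrightarrow> (\<lambda>p q. {tuple_inner p q}) respects2 lcov_rel U"
  by (intro congruent2I') (auto simp: lcov_rel_def tuple_inner_lcov_vec)

end

theory Submission
  imports Defs
begin

text \<open>
  Write \<open>P = mat 1 - U ** transpose U\<close> for the projection along the column space of \<open>U\<close>. The tuple
  \<open>(b, transpose U *v b)\<close> represents the vector \<open>P *v b\<close>, so sending a vector to the set of all tuples
  that represent it turns \<open>P *v b\<close> into the SV-LCOV form of \<open>b\<close>. Two tuples are identified exactly
  when they represent the same vector, the operations on tuples are those on the represented
  vectors (\<open>lcov_vec_add\<close>, \<open>lcov_vec_scale\<close>), and the orthonormality of the columns of \<open>U\<close> makes the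
  inner product of tuples agree with the dot product (\<open>tuple_inner_lcov_vec\<close>). Hence the whole range
  of \<open>P\<close> corresponds isometrically to the whole space of SV-LCOV forms
  (\<open>linear_isometry_lcov_fibre\<close>).

  A linear isometry carries the span of any set onto the span of its image
  (\<open>linear_isometry_spanned_space\<close>). For the set of columns \<open>P *v b\<close> of \<open>P ** B\<close> this gives the
  theorem, because the image consists of the forms of the columns \<open>b\<close> of \<open>B\<close>. The inner product
  axioms for the span of the forms are transported along the isometry from the column space
  (\<open>linear_isometry_inner_product_space\<close>).
\<close>

section \<open>Linear isometries and spans\<close>

text \<open>
  Preservation of zero is listed separately so that the notion makes sense, and can be used to
  transport structure, before the target is known to satisfy the inner product axioms.
\<close>

definition linear_isometry :: "'a ips \<Rightarrow> 'b ips \<Rightarrow> ('a \<Rightarrow> 'b) \<Rightarrow> bool" where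
  "linear_isometry V W f \<longleftrightarrow> bij_betw f (vecs V) (vecs W) \<and> f (vzero V) = vzero W \<and>
    (\<forall>x\<in>vecs V. \<forall>y\<in>vecs V. f (vadd V x y) = vadd W (f x) (f y)) \<and>
    (\<forall>a. \<forall>x\<in>vecs V. f (vscale V a x) = vscale W a (f x)) \<and>
    (\<forall>x\<in>vecs V. \<forall>y\<in>vecs V. vinner W (f x) (f y) = vinner V x y)"

lemma linear_isometryD:
  assumes "linear_isometry V W f"
  shows "bij_betw f (vecs V) (vecs W)"
    and "vecs W = f ` vecs V"
    and "inj_on f (vecs V)"
    and "f (vzero V) = vzero W"
    and "\<And>x y. \<lbrakk>x \<in> vecs V; y \<in> vecs V\<rbrakk> \<Longrightarrow> vadd W (f x) (f y) = f (vadd V x y)"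
    and "\<And>a x. x \<in> vecs V \<Longrightarrow> vscale W a (f x) = f (vscale V a x)"
    and "\<And>x y. \<lbrakk>x \<in> vecs V; y \<in> vecs V\<rbrakk> \<Longrightarrow> vinner W (f x) (f y) = vinner V x y"
  using assms by (auto simp: linear_isometry_def bij_betw_def)

lemma linear_isometry_inner_product_space:
  assumes V: "inner_product_space V" and f: "linear_isometry V W f"
  shows "inner_product_space W"
proof -
  interpret inner_product_space V by (rule V)
  note f_simps = linear_isometryD(5-7)[OF f] linear_isometryD(4)[OF f, symmetric]
  note closed = zero_closed add_closed scale_closed
  show ?thesis
  proof (unfold_locales, unfold linear_isometryD(2)[OF f])
    fix x assume "x \<in> f ` vecs V"
    then obtain u where u: "u \<in> vecs V" "x = f u" by blast
    then obtain v where "v \<in> vecs V" "vadd V u v = vzero V" using add_inverse by blast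
    with u show "\<exists>y\<in>f ` vecs V. vadd W x y = vzero W"
      by (intro bexI[where x = "f v"]) (simp_all add: f_simps)
  next
    fix x assume "x \<in> f ` vecs V" "vinner W x x = 0"
    then show "x = vzero W" by (auto simp: f_simps closed dest: inner_eq_zero)
  qed (auto simp: f_simps closed add_assoc add_zero scale_add_right scale_add_left scale_scale
      scale_one inner_add_left inner_scale_left inner_nonneg
      intro: arg_cong[where f = f, OF add_commute] inner_commute)
qed

lemma linear_isometry_imp_isometric:
  assumes "inner_product_space V" and "linear_isometry V W f"
  shows "isometric V W"
  using assms linear_isometry_inner_product_space[OF assms]
  unfolding isometric_def linear_isometry_def by blast

lemma linear_subspace_vecs: "inner_product_space V \<Longrightarrow> linear_subspace V (vecs V)"
  by (simp add: linear_subspace_def inner_product_space.zero_closed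
      inner_product_space.add_closed inner_product_space.scale_closed)

text \<open>
  The hull is an intersection of subspaces; \<open>vecs V\<close> takes part in it, so that the hull stays inside
  the carrier.
\<close>

lemma linear_subspace_hull:
  assumes "inner_product_space V" and "S \<subseteq> vecs V"
  shows "linear_subspace V (linear_subspace V hull S)"
proof -
  have "linear_subspace V hull S \<subseteq> vecs V"
    using assms by (intro hull_minimal linear_subspace_vecs)
  then show ?thesis
    by (auto simp: linear_subspace_def hull_def)
qed

lemma linear_isometry_image_subspace:
  assumes f: "linear_isometry V W f" and T: "linear_subspace V T"
  shows "linear_subspace W (f ` T)"
proof -
  have "T \<subseteq> vecs V" using T by (simp add: linear_subspace_def)
  then show ?thesis
    using T linear_isometryD(4)[OF f, symmetric]
    by (auto simp: linear_subspace_def linear_isometryD(2)[OF f] subset_iff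
        linear_isometryD(5,6)[OF f])
qed

lemma linear_isometry_vimage_subspace:
  assumes V: "inner_product_space V" and f: "linear_isometry V W f" and T: "linear_subspace W T"
  shows "linear_subspace V {x \<in> vecs V. f x \<in> T}"
proof -
  interpret inner_product_space V by (rule V)
  show ?thesis
    using T unfolding linear_subspace_def
    by (auto simp: zero_closed add_closed scale_closed linear_isometryD(4)[OF f]
        linear_isometryD(5,6)[OF f, symmetric])
qed

text \<open>
  Images and preimages of subspaces under an isometry are subspaces. The preimage of the hull of
  \<open>f ` S\<close> is therefore a subspace that contains \<open>S\<close>, and the image of the hull of \<open>S\<close> one that
  contains \<open>f ` S\<close>; minimality of the two hulls gives the two inclusions.
\<close>

lemma linear_isometry_image_hull:
  assumes V: "inner_product_space V" and f: "linear_isometry V W f" and S: "S \<subseteq> vecs V"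
  shows "f ` (linear_subspace V hull S) = linear_subspace W hull (f ` S)"
proof
  have W: "inner_product_space W" by (rule linear_isometry_inner_product_space[OF V f])
  have "f ` S \<subseteq> vecs W" using S linear_isometryD(2)[OF f] by blast
  then have "linear_subspace V {x \<in> vecs V. f x \<in> linear_subspace W hull (f ` S)}"
    by (intro linear_isometry_vimage_subspace[OF V f] linear_subspace_hull[OF W])
  moreover have "S \<subseteq> {x \<in> vecs V. f x \<in> linear_subspace W hull (f ` S)}"
    using S by (auto intro: hull_inc)
  ultimately have "linear_subspace V hull S \<subseteq> {x \<in> vecs V. f x \<in> linear_subspace W hull (f ` S)}"
    by (intro hull_minimal)
  then show "f ` (linear_subspace V hull S) \<subseteq> linear_subspace W hull (f ` S)" by blast
  show "linear_subspace W hull (f ` S) \<subseteq> f ` (linear_subspace V hull S)"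
    by (intro hull_minimal image_mono hull_subset linear_isometry_image_subspace[OF f]
        linear_subspace_hull[OF V S])
qed

lemma linear_isometry_spanned_space:
  assumes V: "inner_product_space V" and f: "linear_isometry V W f" and S: "S \<subseteq> vecs V"
  shows "linear_isometry (spanned_space V S) (spanned_space W (f ` S)) f"
proof -
  have "linear_subspace V hull S \<subseteq> vecs V"
    using V S by (intro hull_minimal linear_subspace_vecs)
  moreover from this have
    "bij_betw f (linear_subspace V hull S) (linear_subspace W hull (f ` S))"
    by (rule bij_betw_subset[OF linear_isometryD(1)[OF f] _ linear_isometry_image_hull[OF V f S]])
  ultimately show ?thesis
    using f by (auto simp: linear_isometry_def spanned_space_def subset_iff)
qed

section \<open>Column spaces\<close>

lemma inner_product_space_column_space: "inner_product_space (column_space A)"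
  by unfold_locales
    (auto simp: column_space_def span_zero span_add span_scale inner_commute algebra_simps
      inner_add_left intro: bexI[where x = "- x" for x] span_neg)

lemma span_columns: "span (columns A) = range ((*v) (A :: real^'s^'m))"
proof
  show "span (columns A) \<subseteq> range ((*v) A)"
    by (rule span_minimal)
      (auto simp: columns_image_basis intro: linear_subspace_image[of "(*v) A" UNIV])
  show "range ((*v) A) \<subseteq> span (columns A)"
    using matrix_vector_mult_in_columnspace by blast
qed

lemma columns_matrix_mult: "columns (A ** B) = (*v) A ` columns (B :: real^'s^'n)"
proof -
  have "column j (A ** B) = A *v column j B" for j
    by (simp add: column_def matrix_matrix_mult_def matrix_vector_mult_def)
  then show ?thesis by (auto simp: columns_def)
qed

lemma linear_subspace_hull_column_space:
  assumes "S \<subseteq> vecs (column_space A)"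
  shows "linear_subspace (column_space A) hull S = span S"
proof (rule hull_unique)
  show "S \<subseteq> span S" by (rule span_superset)
  have "span S \<subseteq> span (columns A)"
    using assms by (simp add: column_space_def span_minimal)
  then show "linear_subspace (column_space A) (span S)"
    by (auto simp: linear_subspace_def column_space_def span_zero span_add span_scale)
  fix T assume "S \<subseteq> T" "linear_subspace (column_space A) T"
  then show "span S \<subseteq> T"
    by (intro span_minimal) (auto simp: linear_subspace_def column_space_def subspace_def)
qed

text \<open>
  This exhibits \<open>column_space (A ** B)\<close> as a space to which \<open>linear_isometry_spanned_space\<close> applies,
  with an isometry that is defined on the whole column space of \<open>A\<close>.
\<close>

lemma spanned_space_column_space:
  "spanned_space (column_space A) (columns (A ** B)) = column_space (A ** B)"
proof -
  have "columns (A ** B) \<subseteq> vecs (column_space A)"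
    by (auto simp: column_space_def span_columns columns_matrix_mult)
  from linear_subspace_hull_column_space[OF this] show ?thesis
    by (simp add: spanned_space_def) (simp add: column_space_def)
qed

section \<open>Vectors as classes of the tuples that represent them\<close>

text \<open>
  For \<open>z\<close> in the range of the projection this is the class that corresponds to \<open>z\<close>, described
  without a choice of \<open>b\<close> with \<open>z = (mat 1 - U ** transpose U) *v b\<close>. For other \<open>z\<close> it is empty.
\<close>

definition lcov_fibre :: "real^'k^'m \<Rightarrow> real^'m \<Rightarrow> ((real^'m) \<times> (real^'k)) set" where
  "lcov_fibre U z = {p \<in> lcov_tuples U. lcov_vec U p = z}"

lemma lcov_vec_canonical:
  "lcov_vec U (b, transpose U *v b) = (mat 1 - U ** transpose U) *v b"
  by (simp add: lcov_vec_def matrix_vector_mult_diff_rdistrib matrix_vector_mul_assoc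
      del: transpose_matrix_vector)

lemma vecs_column_space_projection:
  "vecs (column_space (mat 1 - U ** transpose U)) = lcov_vec U ` lcov_tuples U"
  by (auto simp: column_space_def span_columns lcov_tuples_def image_iff lcov_vec_canonical
      simp del: transpose_matrix_vector)

lemma lcov_fibre_lcov_vec:
  "p \<in> lcov_tuples U \<Longrightarrow> lcov_fibre U (lcov_vec U p) = lcov_rel U `` {p}"
  by (auto simp: lcov_fibre_def lcov_rel_def)

lemma lcov_form_eq_fibre:
  "lcov_form U b = lcov_fibre U ((mat 1 - U ** transpose U) *v b)"
  unfolding lcov_form_def lcov_vec_canonical[symmetric]
  by (rule lcov_fibre_lcov_vec[symmetric]) (simp add: lcov_tuples_def)

text \<open>
  Every vector in the domain has the form \<open>lcov_vec U p\<close>, and its fibre is the class of \<open>p\<close>. So each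
  condition reduces to a statement about representatives: the map is injective because a class
  determines the vector that its members represent, it is linear because \<open>lcov_vec U\<close> is, and it
  preserves the inner product because the columns of \<open>U\<close> are orthonormal.
\<close>

lemma linear_isometry_lcov_fibre:
  assumes U: "transpose U ** U = mat 1"
  shows "linear_isometry (column_space (mat 1 - U ** transpose U)) (lcov_space U) (lcov_fibre U)"
proof -
  note eqv = equiv_lcov_rel[of U]
  have zero: "0 \<in> lcov_tuples U" "lcov_vec U 0 = 0"
    by (simp_all add: lcov_tuples_def lcov_vec_def zero_prod_def)
  have "bij_betw (lcov_fibre U) (lcov_vec U ` lcov_tuples U) (lcov_tuples U // lcov_rel U)"
  proof (rule bij_betw_imageI)
    show "inj_on (lcov_fibre U) (lcov_vec U ` lcov_tuples U)"
      by (force simp: inj_on_def lcov_fibre_def)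
    show "lcov_fibre U ` lcov_vec U ` lcov_tuples U = lcov_tuples U // lcov_rel U"
      by (auto simp: quotient_def lcov_fibre_lcov_vec image_iff)
  qed
  moreover have "lcov_fibre U 0 = lcov_rel U `` {0}"
    using lcov_fibre_lcov_vec[OF zero(1)] zero(2) by simp
  moreover have "lcov_fibre U (lcov_vec U p + lcov_vec U q)
      = vadd (lcov_space U) (lcov_fibre U (lcov_vec U p)) (lcov_fibre U (lcov_vec U q))"
    if "p \<in> lcov_tuples U" "q \<in> lcov_tuples U" for p q
    using that lcov_fibre_lcov_vec[OF lcov_tuples_add[OF that]]
    by (simp add: lcov_space_def lcov_fibre_lcov_vec lcov_vec_add
        UN_equiv_class2[OF eqv eqv lcov_add_congruent])
  moreover have "lcov_fibre U (a *\<^sub>R lcov_vec U p)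
      = vscale (lcov_space U) a (lcov_fibre U (lcov_vec U p))"
    if "p \<in> lcov_tuples U" for a p
    using that lcov_fibre_lcov_vec[OF lcov_tuples_scale[OF that]]
    by (simp add: lcov_space_def lcov_fibre_lcov_vec lcov_vec_scale
        UN_equiv_class[OF eqv lcov_scale_congruent])
  moreover have "vinner (lcov_space U) (lcov_fibre U (lcov_vec U p)) (lcov_fibre U (lcov_vec U q))
      = lcov_vec U p \<bullet> lcov_vec U q"
    if "p \<in> lcov_tuples U" "q \<in> lcov_tuples U" for p q
    using that
    by (simp add: lcov_space_def lcov_fibre_lcov_vec tuple_inner_lcov_vec[OF U]
        UN_equiv_class2[OF eqv eqv tuple_inner_congruent[OF U]])
  ultimately show ?thesis
    unfolding linear_isometry_def vecs_column_space_projection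
    by (simp add: column_space_def) (simp add: lcov_space_def)
qed

theorem lemma3:
  fixes U :: "real^'k^'m" and B :: "real^'s^'m"
  assumes "transpose U ** U = mat 1"
  shows "isometric (column_space ((mat 1 - U ** transpose U) ** B))
    (spanned_space (lcov_space U) (lcov_form U ` columns B))"
proof -
  let ?P = "mat 1 - U ** transpose U"
  have "columns (?P ** B) \<subseteq> vecs (column_space ?P)"
    by (auto simp: column_space_def span_columns columns_matrix_mult)
  then have "linear_isometry (spanned_space (column_space ?P) (columns (?P ** B)))
      (spanned_space (lcov_space U) (lcov_fibre U ` columns (?P ** B))) (lcov_fibre U)"
    by (rule linear_isometry_spanned_space[OF inner_product_space_column_space
          linear_isometry_lcov_fibre[OF assms]])
  moreover have "lcov_fibre U ` columns (?P ** B) = lcov_form U ` columns B"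
    by (simp add: columns_matrix_mult image_image lcov_form_eq_fibre)
  ultimately show ?thesis
    by (intro linear_isometry_imp_isometric[OF inner_product_space_column_space])
      (simp add: spanned_space_column_space)
qed

end
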